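(* Let $n\ge 3$ be an odd integer. The characteristic polynomial of the Laplacian matrix of $\Delta(SD_{8n})$ is \[\Phi(L(\Delta(SD_{8n})),x)=x(x-8n)^4(x-4)^{n}(x-8)^{3n}(x-4n)^{4n-5}.\]
   Context: For an integer $n\ge 2$, the semidihedral group is $SD_{8n}=\langle a,b : a^{4n}=b^2=e,\ ba=a^{2n-1}b\rangle$, a group of order $8n$. The commuting graph $\Delta(G)$ of a group $G$ is the simple graph with vertex set $G$ in which two distinct vertices $x,y$ are adjacent iff $xy=yx$. The Laplacian matrix of a finite graph $\Gamma$ is $L(\Gamma)=D(\Gamma)-A(\Gamma)$, where $A(\Gamma)$ is the adjacency matrix and $D(\Gamma)$ is the diagonal matrix of vertex degrees; $\Phi(L(\Gamma),x)=\det(xI-L(\Gamma))$. *)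

theory Defs
  imports
    "HOL-Algebra.Group"
    "HOL-Algebra.Coset"
    "Graph_Theory.Pair_Digraph"
    "Jordan_Normal_Form.Char_Poly"
begin

section \<open>Groups given by a presentation\<close>

text \<open>The letter \<open>(g, False)\<close> stands for the generator \<open>g\<close>, and \<open>(g, True)\<close> for its formal inverse.\<close>

type_synonym 'g word = "('g \<times> bool) list"

text \<open>The congruence on words whose quotient is the group with generators \<open>UNIV\<close> and defining
  relations \<open>u = v\<close> for \<open>(u, v) \<in> R\<close>.\<close>

inductive word_eq :: "('g word \<times> 'g word) set \<Rightarrow> 'g word \<Rightarrow> 'g word \<Rightarrow> bool"
  for R :: "('g word \<times> 'g word) set" where
  relation: "(u, v) \<in> R \<Longrightarrow> word_eq R u v"
| cancel: "word_eq R [(g, s), (g, \<not> s)] []"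
| congruence: "word_eq R u v \<Longrightarrow> word_eq R (p @ u @ q) (p @ v @ q)"
| refl: "word_eq R u u"
| sym: "word_eq R u v \<Longrightarrow> word_eq R v u"
| trans: "word_eq R u v \<Longrightarrow> word_eq R v w \<Longrightarrow> word_eq R u w"

definition word_class :: "('g word \<times> 'g word) set \<Rightarrow> 'g word \<Rightarrow> 'g word set" where
  "word_class R u = {v. word_eq R u v}"

definition presented_group :: "('g word \<times> 'g word) set \<Rightarrow> 'g word set monoid" where
  "presented_group R =
    \<lparr>carrier = range (word_class R),
     monoid.mult = (\<lambda>X Y. \<Union>u\<in>X. \<Union>v\<in>Y. word_class R (u @ v)),
     one = word_class R []\<rparr>"

lemma word_class_eq_iff: "word_class R u = word_class R v \<longleftrightarrow> word_eq R u v"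
  unfolding word_class_def set_eq_iff mem_Collect_eq
  by (meson word_eq.refl word_eq.sym word_eq.trans)

lemma word_eq_append:
  assumes "word_eq R u u'" and "word_eq R v v'"
  shows "word_eq R (u @ v) (u' @ v')"
  using word_eq.congruence[OF assms(1), of "[]" v] word_eq.congruence[OF assms(2), of u' "[]"]
  by simp (rule word_eq.trans)

lemma presented_group_mult:
  "word_class R u \<otimes>\<^bsub>presented_group R\<^esub> word_class R v = word_class R (u @ v)"
proof -
  have "word_class R (u' @ v') = word_class R (u @ v)"
    if "u' \<in> word_class R u" "v' \<in> word_class R v" for u' v'
    unfolding word_class_eq_iff
    by (rule word_eq.sym, rule word_eq_append) (use that in \<open>simp_all add: word_class_def\<close>)
  then have "(\<Union>u'\<in>word_class R u. \<Union>v'\<in>word_class R v. word_class R (u' @ v'))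
      = (\<Union>u'\<in>word_class R u. \<Union>v'\<in>word_class R v. word_class R (u @ v))"
    by (intro SUP_cong HOL.refl)
  also have "\<dots> = word_class R (u @ v)"
  proof -
    have "u \<in> word_class R u" "v \<in> word_class R v"
      by (simp_all add: word_class_def word_eq.refl)
    then show ?thesis by blast
  qed
  finally show ?thesis
    by (simp add: presented_group_def)
qed

lemma word_eq_inverse: "word_eq R (map (\<lambda>(g, s). (g, \<not> s)) (rev u) @ u) []"
proof (induction u)
  case Nil
  show ?case by (simp add: word_eq.refl)
next
  case (Cons x u)
  obtain g s where x: "x = (g, s)" by (cases x)
  let ?v = "map (\<lambda>(g, s). (g, \<not> s)) (rev u)"
  have "word_eq R (?v @ [(g, \<not> s), (g, \<not> \<not> s)] @ u) (?v @ [] @ u)"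
    by (intro word_eq.congruence word_eq.cancel)
  then show ?case
    using word_eq.trans[OF _ Cons.IH] by (simp add: x)
qed

lemma group_presented_group: "group (presented_group R)"
proof (rule groupI)
  fix X assume "X \<in> carrier (presented_group R)"
  then obtain u where u: "X = word_class R u"
    by (auto simp: presented_group_def)
  let ?v = "map (\<lambda>(g, s). (g, \<not> s)) (rev u)"
  have "word_class R ?v \<otimes>\<^bsub>presented_group R\<^esub> X = \<one>\<^bsub>presented_group R\<^esub>"
    using word_eq_inverse[of R u]
    by (simp add: u presented_group_mult word_class_eq_iff, simp add: presented_group_def word_class_eq_iff)
  then show "\<exists>Y\<in>carrier (presented_group R). Y \<otimes>\<^bsub>presented_group R\<^esub> X = \<one>\<^bsub>presented_group R\<^esub>"
    by (auto simp: presented_group_def)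
next
  have one: "\<one>\<^bsub>presented_group R\<^esub> = word_class R []"
    and car: "carrier (presented_group R) = range (word_class R)"
    by (simp_all add: presented_group_def)
  show "\<one>\<^bsub>presented_group R\<^esub> \<in> carrier (presented_group R)"
    by (auto simp: one car)
  fix X assume X: "X \<in> carrier (presented_group R)"
  show "\<one>\<^bsub>presented_group R\<^esub> \<otimes>\<^bsub>presented_group R\<^esub> X = X"
    using X by (auto simp: one car presented_group_mult)
  fix Y assume Y: "Y \<in> carrier (presented_group R)"
  show "X \<otimes>\<^bsub>presented_group R\<^esub> Y \<in> carrier (presented_group R)"
    using X Y by (auto simp: car presented_group_mult)
  fix Z assume "Z \<in> carrier (presented_group R)"
  then show "X \<otimes>\<^bsub>presented_group R\<^esub> Y \<otimes>\<^bsub>presented_group R\<^esub> Z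
      = X \<otimes>\<^bsub>presented_group R\<^esub> (Y \<otimes>\<^bsub>presented_group R\<^esub> Z)"
    using X Y by (auto simp: car presented_group_mult)
qed


section \<open>The semidihedral group of order \<open>8 n\<close>\<close>

datatype sd_generator = gen_a | gen_b

abbreviation "word_a \<equiv> [(gen_a, False)]"
abbreviation "word_b \<equiv> [(gen_b, False)]"

definition word_power :: "'g word \<Rightarrow> nat \<Rightarrow> 'g word" where
  "word_power w k = concat (replicate k w)"

definition SD_relations :: "nat \<Rightarrow> (sd_generator word \<times> sd_generator word) set" where
  "SD_relations n =
    {(word_power word_a (4 * n), []),
     (word_power word_b 2, []),
     (word_b @ word_a, word_power word_a (2 * n - 1) @ word_b)}"

text \<open>Used for \<open>n \<ge> 2\<close>; the index is \<open>n\<close>, whereas the order of the group is \<open>8 n\<close>.\<close>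

definition SD :: "nat \<Rightarrow> sd_generator word set monoid" where
  "SD n = presented_group (SD_relations n)"

lemma group_SD: "group (SD n)"
  unfolding SD_def by (rule group_presented_group)

lemma SD_order:
  assumes "n \<ge> 1"
  shows "Coset.order (SD n) = 8 * n"
proof -
  let ?E = "word_eq (SD_relations n)"
  let ?N = "4 * n"
  define A where "A = word_power word_a"
  define B where "B j = (if j then word_b else [])" for j :: bool
  have A0: "A 0 = []" and A1: "A (Suc 0) = word_a"
    and Aadd: "A (i + k) = A i @ A k" for i k
    by (simp_all add: A_def word_power_def replicate_add)
  have AS: "A (Suc i) = word_a @ A i" for i
    using Aadd[of 1 i] A1 by simp
  have ctx: "?E (p @ u @ q) (p @ v @ q)" if "?E u v" for p q u v
    using that by (rule word_eq.congruence)
  have rA: "?E (A ?N) []" and rB: "?E (word_b @ word_b) []"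
    and rBA: "?E (word_b @ word_a) (A (2 * n - 1) @ word_b)"
    using word_eq.relation[of _ _ "SD_relations n"]
    by (auto simp: SD_relations_def A_def word_power_def numeral_2_eq_2)
  note tr = word_eq.trans[of "SD_relations n"]

  have Amult: "?E (A (k * ?N)) []" for k
  proof (induction k)
    case 0 show ?case by (simp add: A0 word_eq.refl)
  next
    case (Suc k)
    show ?case using word_eq_append[OF rA Suc] by (simp flip: Aadd)
  qed
  have Amod: "?E (A i) (A (i mod ?N))" for i
    using word_eq_append[OF Amult[of "i div ?N"] word_eq.refl[of _ "A (i mod ?N)"]]
    by (simp only: Aadd[symmetric] div_mult_mod_eq append_Nil)
  have BA: "?E (word_b @ A i) (A ((2 * n - 1) * i) @ word_b)" for i
  proof (induction i)
    case 0 show ?case by (simp add: A0 word_eq.refl)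
  next
    case (Suc i)
    have "?E (word_b @ A (Suc i)) (A (2 * n - 1) @ word_b @ A i)"
      using ctx[OF rBA, of "[]" "A i"] by (simp add: AS)
    from tr[OF this] ctx[OF Suc, of "A (2 * n - 1)" "[]"] show ?case
      by (simp add: Aadd)
  qed

  have normal: "\<exists>i j. ?E w (A i @ B j)" for w
  proof (induction w)
    case Nil
    have "?E [] (A 0 @ B False)" by (simp add: A0 B_def word_eq.refl)
    then show ?case by blast
  next
    case (Cons x w)
    then obtain i j where ij: "?E w (A i @ B j)" by blast
    have x: "?E [x] (A 1) \<or> ?E [x] (A (?N - 1)) \<or> ?E [x] word_b"
    proof -
      obtain g s where gs: "x = (g, s)" by (cases x)
      have ia: "?E [(gen_a, True)] (A (?N - 1))"
      proof -
        have 1: "?E ([(gen_a, True)] @ A ?N) (A (?N - 1))"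
          using ctx[OF word_eq.cancel[of _ gen_a True], of "[]" "A (?N - 1)"]
            AS[of "?N - 1"] assms by simp
        have 2: "?E ([(gen_a, True)] @ A ?N) [(gen_a, True)]"
          using ctx[OF rA, of "[(gen_a, True)]" "[]"] by simp
        show ?thesis by (rule tr[OF word_eq.sym[OF 2] 1])
      qed
      have ib: "?E [(gen_b, True)] word_b"
      proof -
        have 1: "?E ([(gen_b, True)] @ word_b @ word_b) word_b"
          using ctx[OF word_eq.cancel[of _ gen_b True], of "[]" word_b] by simp
        have 2: "?E ([(gen_b, True)] @ word_b @ word_b) [(gen_b, True)]"
          using ctx[OF rB, of "[(gen_b, True)]" "[]"] by simp
        show ?thesis by (rule tr[OF word_eq.sym[OF 2] 1])
      qed
      show ?thesis
        using ia ib by (cases g; cases s) (auto simp: gs A1 word_eq.refl)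
    qed
    have xw: "?E (x # w) (u @ A i @ B j)" if "?E [x] u" for u
      using word_eq_append[OF that ij] by simp
    have *: "\<exists>i j. ?E (x # w) (A i @ B j)" if "?E [x] (A k)" for k
      using xw[OF that] by (auto simp flip: Aadd append_assoc)
    have "\<exists>i j. ?E (x # w) (A i @ B j)" if "?E [x] word_b"
    proof -
      have 1: "?E (x # w) (A ((2 * n - 1) * i) @ word_b @ B j)"
        using tr[OF xw[OF that]] ctx[OF BA[of i], of "[]" "B j"] by simp
      have "?E (word_b @ B j) (B (\<not> j))"
        using rB by (cases j) (auto simp: B_def word_eq.refl)
      from tr[OF 1] ctx[OF this, of "A ((2 * n - 1) * i)" "[]"] show ?thesis by auto
    qed
    with * x show ?case by blast
  qed

  text \<open>\<open>act w (i, j)\<close> computes \<open>w\<close> times \<open>a\<close> to the power \<open>i\<close> times \<open>b\<close> to the power \<open>j\<close>.\<close>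
  define act1 :: "sd_generator \<times> bool \<Rightarrow> int \<times> bool \<Rightarrow> int \<times> bool" where
    "act1 x = (\<lambda>(i, j). if fst x = gen_b then (((2 * int n - 1) * i) mod int ?N, \<not> j)
        else if snd x then ((i - 1) mod int ?N, j) else ((i + 1) mod int ?N, j))" for x
  define X :: "(int \<times> bool) set" where "X = {0..<int ?N} \<times> UNIV"
  define act where "act w = foldr act1 w" for w
  have actapp: "act (u @ v) x = act u (act v x)" for u v x
    by (simp add: act_def)
  have act1X: "act1 x y \<in> X" for x y
    using assms by (auto simp: act1_def X_def split: prod.splits)
  have actX: "y \<in> X \<Longrightarrow> act w y \<in> X" for w y
    by (cases w) (auto simp: act_def act1X)
  have actA: "act (A k) (i, j) = ((i + int k) mod int ?N, j)" if "(i, j) \<in> X" for i j k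
  proof (induction k)
    case 0 show ?case using that by (auto simp: A0 act_def X_def)
  next
    case (Suc k)
    have "act (A (Suc k)) (i, j) = act1 (gen_a, False) (act (A k) (i, j))"
      by (simp add: AS act_def)
    then show ?case by (simp add: Suc act1_def mod_simps algebra_simps)
  qed
  have key: "((2 * int n - 1) * ((2 * int n - 1) * i)) mod int ?N = i mod int ?N" for i
  proof -
    have "(2 * int n - 1) * ((2 * int n - 1) * i) = i + int ?N * ((int n - 1) * i)"
      by (simp add: algebra_simps)
    then show ?thesis by (simp only: mod_mult_self2)
  qed
  have act_eq: "act u y = act v y" if "?E u v" "y \<in> X" for u v y
    using that
  proof (induction arbitrary: y rule: word_eq.induct)
    case (relation u v)
    obtain i j where y: "y = (i, j)" by (cases y)
    with relation have i: "i mod int ?N = i" and ij: "(i, j) \<in> X" by (auto simp: X_def)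
    have 1: "act (A ?N) y = act [] y"
      using i actA[OF ij, of ?N] by (simp add: act_def y)
    have 2: "act (word_b @ word_b) y = act [] y"
      using key[of i] i by (simp add: act_def act1_def y mod_mult_right_eq)
    have 3: "act (word_b @ word_a) y = act (A (2 * n - 1) @ word_b) y"
    proof -
      let ?c = "2 * int n - 1"
      have "((?c * i) mod int ?N, \<not> j) \<in> X"
        using assms by (auto simp: X_def)
      moreover have "int (2 * n - 1) = ?c"
        using assms by (simp add: of_nat_diff)
      moreover have "act word_b y = ((?c * i) mod int ?N, \<not> j)"
        by (simp add: act_def act1_def y)
      ultimately have "act (A (2 * n - 1) @ word_b) y = (((?c * i) mod int ?N + ?c) mod int ?N, \<not> j)"
        by (simp only: actapp actA)
      also have "((?c * i) mod int ?N + ?c) mod int ?N = (?c * ((i + 1) mod int ?N)) mod int ?N"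
        by (simp only: mod_add_left_eq mod_mult_right_eq distrib_left mult_1_right)
      finally show ?thesis
        by (simp add: act_def act1_def y)
    qed
    from relation(1) 1 2 3 show ?case
      by (auto simp: SD_relations_def A_def word_power_def numeral_2_eq_2)
  next
    case (cancel g s)
    then have i: "fst y mod int ?N = fst y" by (auto simp: X_def)
    show ?case
      using i key[of "fst y"]
      by (cases y) (auto simp: act_def act1_def mod_mult_right_eq mod_simps)
  next
    case (congruence u v p q)
    then show ?case by (simp add: actapp actX)
  qed auto

  define f where "f = (\<lambda>(i, j). word_class (SD_relations n) (A (nat i) @ B j))"
  have fX: "carrier (SD n) = f ` X"
  proof
    show "f ` X \<subseteq> carrier (SD n)"
      by (auto simp: f_def SD_def presented_group_def)
    show "carrier (SD n) \<subseteq> f ` X"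
    proof
      fix W assume "W \<in> carrier (SD n)"
      then obtain w where W: "W = word_class (SD_relations n) w"
        by (auto simp: SD_def presented_group_def)
      obtain i j where ij: "?E w (A i @ B j)" using normal by blast
      have "?E w (A (i mod ?N) @ B j)"
        using tr[OF ij] ctx[OF Amod[of i], of "[]" "B j"] by simp
      then have "W = f (int (i mod ?N), j)"
        by (simp add: W f_def word_class_eq_iff)
      moreover have "int (i mod ?N) < int ?N"
        unfolding of_nat_less_iff using assms by (intro mod_less_divisor) simp
      then have "(int (i mod ?N), j) \<in> X" unfolding X_def by simp
      ultimately show "W \<in> f ` X" by blast
    qed
  qed
  have actf: "act (A (nat i) @ B j) (0, False) = (i, j)" if "(i, j) \<in> X" for i j
  proof -
    have "act (B j) (0, False) = (0, j)" by (simp add: B_def act_def act1_def)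
    moreover have "(0, j) \<in> X" using assms by (simp add: X_def)
    ultimately show ?thesis using actA that by (simp add: actapp X_def)
  qed
  have "inj_on f X"
  proof (rule inj_onI)
    fix x y assume xy: "x \<in> X" "y \<in> X" "f x = f y"
    have 0: "(0, False) \<in> X" using assms by (simp add: X_def)
    obtain i j k l where ijkl: "x = (i, j)" "y = (k, l)" by (cases x; cases y) 
    have "?E (A (nat i) @ B j) (A (nat k) @ B l)"
      using xy by (simp add: f_def ijkl word_class_eq_iff)
    from act_eq[OF this 0] show "x = y" using xy actf by (simp add: ijkl)
  qed
  then have "card (f ` X) = 8 * n"
    by (simp add: card_image X_def card_cartesian_product)
  then show ?thesis
    by (simp add: Coset.order_def fX)
qed


section \<open>The commuting graph\<close>

text \<open>A simple graph is a \<^locale>\<open>pair_graph\<close>: every undirected edge is represented by its two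
  opposite arcs.\<close>

definition commuting_graph :: "('a, 'b) monoid_scheme \<Rightarrow> 'a pair_pre_digraph" where
  "commuting_graph G =
    \<lparr>pverts = carrier G,
     parcs = {(x, y). x \<in> carrier G \<and> y \<in> carrier G \<and> x \<noteq> y \<and> x \<otimes>\<^bsub>G\<^esub> y = y \<otimes>\<^bsub>G\<^esub> x}\<rparr>"

lemma pair_graph_commuting_graph:
  assumes "finite (carrier G)"
  shows "pair_graph (commuting_graph G)"
proof
  have "parcs (commuting_graph G) \<subseteq> carrier G \<times> carrier G"
    by (auto simp: commuting_graph_def)
  then show "finite (parcs (commuting_graph G))"
    using assms by (auto intro: finite_subset)
qed (auto simp: commuting_graph_def assms symmetric_def intro!: symI)


section \<open>The Laplacian matrix of a finite simple graph\<close>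

text \<open>The list \<open>vs\<close> enumerates the vertices without repetition and fixes the indexing of the rows
  and columns. As each edge is a pair of opposite arcs, the out-degree of a vertex is its degree.\<close>

definition adjacency_matrix :: "'a pair_pre_digraph \<Rightarrow> 'a list \<Rightarrow> real mat" where
  "adjacency_matrix \<Gamma> vs =
    mat (length vs) (length vs) (\<lambda>(i, j). if (vs ! i, vs ! j) \<in> parcs \<Gamma> then 1 else 0)"

definition degree_matrix :: "'a pair_pre_digraph \<Rightarrow> 'a list \<Rightarrow> real mat" where
  "degree_matrix \<Gamma> vs =
    mat (length vs) (length vs) (\<lambda>(i, j). if i = j then real (out_degree (with_proj \<Gamma>) (vs ! i)) else 0)"

definition laplacian_matrix :: "'a pair_pre_digraph \<Rightarrow> 'a list \<Rightarrow> real mat" where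
  "laplacian_matrix \<Gamma> vs = degree_matrix \<Gamma> vs - adjacency_matrix \<Gamma> vs"

end

(* For odd n, write the elements of SD n as a^i b^j. The centre consists of the four powers a^i with
   n | i; all powers of a commute with each other, and a^i b commutes with a^k b iff i = k mod n, but
   with no noncentral power of a. Hence the commuting graph is the join of K_4 with the disjoint union
   of K_(4n-4) and n copies of K_4. Its Laplacian becomes triangular in a suitable basis. *)

theory Submission
  imports Defs
begin

text \<open>Oddness enters through one divisibility. Moving b past a power of a multiplies the
  exponent by 2n - 1, so every commutation question that involves b becomes 4n | (2n - 2) x, where x
  is an exponent or a difference of exponents. With n = 2m + 1 the factor 2n - 2 is 4m and m is
  coprime to n, hence the condition n | x; for even n it would be 2n | x. On the spectral side no
  eigenbasis is built. Unit vectors replace the differences of unit vectors that would be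
  eigenvectors within a clique; the resulting error terms lie in the span of basis vectors of lower
  rank, so the diagonal alone decides. Each basis vector belongs to a vertex, which is why matrices
  are given as functions of two vertices and an enumeration is fixed only to form an actual
  \<open>mat\<close>.\<close>

section \<open>Matrices indexed by vertices\<close>

definition kernel_matrix :: "'v list \<Rightarrow> 'v list \<Rightarrow> ('v \<Rightarrow> 'v \<Rightarrow> 'a) \<Rightarrow> 'a mat" where
  "kernel_matrix xs ys A = mat (length xs) (length ys) (\<lambda>(i, j). A (xs ! i) (ys ! j))"

lemma kernel_matrix_carrier [simp]:
  "kernel_matrix xs ys A \<in> carrier_mat (length xs) (length ys)"
  by (simp add: kernel_matrix_def)

lemma kernel_matrix_dim [simp]:
  "dim_row (kernel_matrix xs ys A) = length xs"
  "dim_col (kernel_matrix xs ys A) = length ys"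
  by (simp_all add: kernel_matrix_def)

lemma kernel_matrix_mult:
  fixes A B :: "'v \<Rightarrow> 'v \<Rightarrow> 'a :: semiring_0"
  assumes "distinct ys"
  shows "kernel_matrix xs ys A * kernel_matrix ys zs B
    = kernel_matrix xs zs (\<lambda>u v. \<Sum>w\<in>set ys. A u w * B w v)"
proof -
  have "(\<Sum>k = 0..<length ys. A u (ys ! k) * B (ys ! k) v) = (\<Sum>w\<in>set ys. A u w * B w v)" for u v
    using sum.reindex_bij_betw[OF bij_betw_nth[OF assms HOL.refl HOL.refl], of "\<lambda>w. A u w * B w v"]
    by (simp add: lessThan_atLeast0)
  then show ?thesis
    by (intro eq_matI) (simp_all add: kernel_matrix_def scalar_prod_def)
qed

lemma kernel_matrix_cong:
  assumes "\<And>u v. u \<in> set xs \<Longrightarrow> v \<in> set ys \<Longrightarrow> A u v = B u v"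
  shows "kernel_matrix xs ys A = kernel_matrix xs ys B"
  using assms by (intro eq_matI) (simp_all add: kernel_matrix_def)

lemma kernel_matrix_one:
  assumes "distinct xs"
  shows "kernel_matrix xs xs (\<lambda>u v. if u = v then 1 else 0) = 1\<^sub>m (length xs)"
  using assms by (intro eq_matI) (simp_all add: kernel_matrix_def nth_eq_iff_index_eq)

text \<open>The base change is a permutation matrix, written as the identity kernel with rows
  enumerated by \<open>xs\<close> and columns by \<open>ys\<close>; multiplying by it only exchanges
  one enumeration for the other.\<close>

lemma similar_kernel_matrix_reorder:
  fixes A :: "'v \<Rightarrow> 'v \<Rightarrow> 'a :: comm_ring_1"
  assumes "distinct xs" and "distinct ys" and "set xs = set ys"
  shows "similar_mat (kernel_matrix xs xs A) (kernel_matrix ys ys A)"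
proof -
  let ?I = "\<lambda>u v. if u = v then 1 else 0 :: 'a"
  have len: "length ys = length xs"
    using assms distinct_card by metis
  have left: "(\<Sum>w\<in>set ys. ?I u w * f w) = f u" if "u \<in> set ys" for u and f :: "'v \<Rightarrow> 'a"
    using that sum.delta'[of "set ys" u f] by (simp add: if_distrib[of "\<lambda>x. x * _"] cong: if_cong)
  have right: "(\<Sum>w\<in>set ys. f w * ?I w v) = f v" if "v \<in> set ys" for v and f :: "'v \<Rightarrow> 'a"
    using that sum.delta[of "set ys" v f] by (simp add: if_distrib[of "\<lambda>x. _ * x"] cong: if_cong)
  have "kernel_matrix xs ys ?I * kernel_matrix ys xs ?I = kernel_matrix xs xs ?I"
    and "kernel_matrix ys xs ?I * kernel_matrix xs ys ?I = kernel_matrix ys ys ?I"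
    and "kernel_matrix xs ys ?I * kernel_matrix ys ys A = kernel_matrix xs ys A"
    and "kernel_matrix xs ys A * kernel_matrix ys xs ?I = kernel_matrix xs xs A"
    unfolding kernel_matrix_mult[OF assms(1)] kernel_matrix_mult[OF assms(2)]
    by (intro kernel_matrix_cong, simp only: assms(3) left right)+
  then have "similar_mat_wit (kernel_matrix xs xs A) (kernel_matrix ys ys A)
      (kernel_matrix xs ys ?I) (kernel_matrix ys xs ?I)"
    using kernel_matrix_carrier[of xs xs A] kernel_matrix_carrier[of ys ys A]
      kernel_matrix_carrier[of xs ys ?I] kernel_matrix_carrier[of ys xs ?I]
    by (simp add: similar_mat_wit_def Let_def len kernel_matrix_one assms(1,2))
  then show ?thesis
    unfolding similar_mat_def by blast
qed

text \<open>Ordered by the rank \<open>\<rho>\<close>, \<open>P\<close> is unitriangular, so its columns form a basis; in this basis \<open>A\<close>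
  becomes the triangular \<open>T\<close>.\<close>

lemma char_poly_kernel_matrix_triangularizable:
  fixes A P T :: "'v \<Rightarrow> 'v \<Rightarrow> 'a :: field" and \<rho> :: "'v \<Rightarrow> nat"
  assumes xs: "distinct xs"
    and AP: "\<And>u v. u \<in> set xs \<Longrightarrow> v \<in> set xs \<Longrightarrow>
      (\<Sum>w\<in>set xs. A u w * P w v) = (\<Sum>w\<in>set xs. P u w * T w v)"
    and P1: "\<And>u. u \<in> set xs \<Longrightarrow> P u u = 1"
    and P: "\<And>u v. u \<in> set xs \<Longrightarrow> v \<in> set xs \<Longrightarrow> u \<noteq> v \<Longrightarrow> P u v \<noteq> 0 \<Longrightarrow> \<rho> v < \<rho> u"
    and T: "\<And>u v. u \<in> set xs \<Longrightarrow> v \<in> set xs \<Longrightarrow> u \<noteq> v \<Longrightarrow> T u v \<noteq> 0 \<Longrightarrow> \<rho> u < \<rho> v"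
  shows "char_poly (kernel_matrix xs xs A) = (\<Prod>v\<in>set xs. [:- T v v, 1:])"
proof -
  define ys where "ys = sort_key \<rho> xs"
  have ys: "distinct ys" "set ys = set xs"
    by (simp_all add: ys_def xs)
  let ?n = "length ys"
  let ?M = "kernel_matrix ys ys"
  have sorted: "\<rho> (ys ! i) \<le> \<rho> (ys ! j)" if "i \<le> j" "j < ?n" for i j
    using sorted_nth_mono[of "map \<rho> ys" i j] that by (simp add: ys_def)
  have mem: "ys ! i \<in> set xs" if "i < ?n" for i
    using that ys(2) nth_mem by blast
  have neq: "ys ! i \<noteq> ys ! j" if "i \<noteq> j" "i < ?n" "j < ?n" for i j
    using that ys(1) by (simp add: nth_eq_iff_index_eq)
  \<comment> \<open>Sorting gives only weak inequalities. The strict ones in the hypotheses also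
    rule out nonzero entries between distinct vertices of equal rank.\<close>
  have "?M P $$ (i, j) = 0" if "i < j" "j < ?n" for i j
    using that P[of "ys ! i" "ys ! j"] sorted[of i j] mem[of i] mem[of j] neq[of i j]
    by (force simp: kernel_matrix_def)
  \<comment> \<open>Unitriangularity gives determinant 1, hence the inverse \<open>Q\<close> that
    turns A P = P T into a similarity.\<close>
  then have "det (?M P) = prod_list (diag_mat (?M P))"
    using kernel_matrix_carrier by (rule det_lower_triangular)
  also have "diag_mat (?M P) = map (\<lambda>_. 1) [0..<?n]"
    using P1 mem by (auto simp: diag_mat_def kernel_matrix_def)
  also have "prod_list \<dots> = 1"
    by (simp add: map_replicate_const)
  finally have "?M P \<in> Units (ring_mat TYPE('a) ?n ())"
    by (intro det_non_zero_imp_unit) simp_all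
  then obtain Q where Q: "Q \<in> carrier_mat ?n ?n" "?M P * Q = 1\<^sub>m ?n" "Q * ?M P = 1\<^sub>m ?n"
    by (auto simp: Units_def ring_mat_def)
  have "?M A * ?M P = ?M P * ?M T"
    unfolding kernel_matrix_mult[OF ys(1)] ys(2)
    by (intro kernel_matrix_cong) (simp add: ys(2) AP)
  moreover have "?M A * (?M P * Q) = ?M A * ?M P * Q"
    using Q(1) by (simp add: assoc_mult_mat[of _ ?n ?n _ ?n _ ?n])
  ultimately have "?M A = ?M P * ?M T * Q"
    using Q(2) kernel_matrix_carrier[of ys ys A] by simp
  then have "similar_mat_wit (?M A) (?M T) (?M P) Q"
    using Q kernel_matrix_carrier[of ys ys A]
    by (simp add: similar_mat_wit_def Let_def)
  then have "char_poly (?M A) = char_poly (?M T)"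
    by (intro char_poly_similar) (auto simp: similar_mat_def)
  also have "\<dots> = (\<Prod>a\<leftarrow>diag_mat (?M T). [:- a, 1:])"
  proof (rule char_poly_upper_triangular)
    show "upper_triangular (?M T)"
    proof (rule upper_triangularI)
      fix i j assume ij: "j < i" "i < dim_row (?M T)"
      then have "i < ?n" by (simp add: kernel_matrix_def)
      with ij show "?M T $$ (i, j) = 0"
        using T[of "ys ! i" "ys ! j"] sorted[of j i] mem[of i] mem[of j] neq[of i j]
        by (force simp: kernel_matrix_def)
    qed
  qed (rule kernel_matrix_carrier)
  also have "diag_mat (?M T) = map (\<lambda>v. T v v) ys"
    by (intro nth_equalityI) (simp_all add: diag_mat_def kernel_matrix_def)
  also have "(\<Prod>a\<leftarrow>map (\<lambda>v. T v v) ys. [:- a, 1:]) = (\<Prod>v\<in>set xs. [:- T v v, 1:])"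
    using ys by (simp add: prod.distinct_set_conv_list[symmetric] comp_def)
  finally show ?thesis
    using char_poly_similar[OF similar_kernel_matrix_reorder[OF xs ys(1) ys(2)[symmetric], of A]]
    by simp
qed

section \<open>The Laplacian of a join of cliques\<close>

text \<open>\<open>R\<close> may be reflexive, as commutation is, so loops are excluded here and not
  in \<open>R\<close>.\<close>

definition laplacian_kernel :: "'v set \<Rightarrow> ('v \<Rightarrow> 'v \<Rightarrow> bool) \<Rightarrow> 'v \<Rightarrow> 'v \<Rightarrow> real" where
  "laplacian_kernel V R u v =
    (if u = v then real (card {w \<in> V. w \<noteq> u \<and> R u w}) else 0) - (if u \<noteq> v \<and> R u v then 1 else 0)"

text \<open>The degree is distributed over the neighbours as differences. The term w = u is zero, so
  a reflexive \<open>R\<close> causes no case distinction later.\<close>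

lemma laplacian_kernel_apply:
  assumes "finite V" and "u \<in> V"
  shows "(\<Sum>w\<in>V. laplacian_kernel V R u w * f w) = (\<Sum>w | w \<in> V \<and> R u w. f u - f w)"
proof -
  let ?N = "{w \<in> V. w \<noteq> u \<and> R u w}"
  have "(\<Sum>w\<in>V. laplacian_kernel V R u w * f w)
      = (\<Sum>w\<in>V. if u = w then real (card ?N) * f w else 0) - (\<Sum>w\<in>V. if w \<noteq> u \<and> R u w then f w else 0)"
    unfolding sum_subtractf[symmetric]
    by (intro sum.cong) (auto simp: laplacian_kernel_def)
  also have "\<dots> = real (card ?N) * f u - (\<Sum>w\<in>?N. f w)"
    using assms by (simp add: sum.inter_filter)
  also have "\<dots> = (\<Sum>w\<in>?N. f u - f w)"
    by (simp add: sum_subtractf)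
  also have "\<dots> = (\<Sum>w | w \<in> V \<and> R u w. f u - f w)"
    using assms(1) by (intro sum.mono_neutral_left) auto
  finally show ?thesis .
qed

text \<open>The join of a complete graph on \<open>C\<close> with the disjoint union of complete graphs on the
  classes \<open>K k\<close>. The basis consists of the all-ones vector, the unit vectors of \<open>C\<close>, the indicators of all
  classes but one, and the unit vectors of the non-representatives; the indicator of the omitted class
  \<open>k0\<close> is the all-ones vector minus the other indicators and the unit vectors of \<open>C\<close>.\<close>

lemma char_poly_laplacian_join_cliques:
  fixes V C :: "'v set" and \<kappa> :: "'v \<Rightarrow> 'k"
  assumes xs: "distinct xs" "set xs = V"
    and C: "C \<subseteq> V" "C \<noteq> V"
    and R: "\<And>u w. u \<in> V \<Longrightarrow> w \<in> V \<Longrightarrow> R u w \<longleftrightarrow> u \<in> C \<or> w \<in> C \<or> \<kappa> u = \<kappa> w"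
  defines "K \<equiv> \<lambda>k. {v \<in> V - C. \<kappa> v = k}"
  shows "char_poly (kernel_matrix xs xs (laplacian_kernel V R)) =
    [:0, 1:] * [:- real (card V), 1:] ^ card C * [:- real (card C), 1:] ^ (card (\<kappa> ` (V - C)) - 1)
      * (\<Prod>k\<in>\<kappa> ` (V - C). [:- real (card C + card (K k)), 1:] ^ (card (K k) - 1))"
proof -
  let ?c = "real (card C)" and ?m = "\<lambda>k. real (card (K k))"
  define I where "I = \<kappa> ` (V - C)"
  have fin: "finite V" "finite C" "finite I" "finite (K k)" for k
    using xs(2) C(1) finite_subset by (auto simp: I_def K_def)
  obtain k0 where k0: "k0 \<in> I" using C by (auto simp: I_def)
  have "\<forall>k\<in>I. \<exists>v. v \<in> V - C \<and> \<kappa> v = k" by (auto simp: I_def)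
  then obtain r where r: "\<And>k. k \<in> I \<Longrightarrow> r k \<in> V - C" "\<And>k. k \<in> I \<Longrightarrow> \<kappa> (r k) = k"
    by metis
  have \<kappa>I: "\<kappa> v \<in> I" if "v \<in> V" "v \<notin> C" for v using that by (auto simp: I_def)
  have r_inj: "r k = r l \<longleftrightarrow> k = l" if "k \<in> I" "l \<in> I" for k l using r(2) that by metis
  define r0 where "r0 = r k0"
  have r0: "r0 \<in> V" "r0 \<notin> C" "\<kappa> r0 = k0" using r k0 by (auto simp: r0_def)
  let ?L = "laplacian_kernel V R"
  \<comment> \<open>Column r0 is the all-ones vector, column r k the indicator of class k for each k
    other than k0, and the remaining columns are unit vectors.\<close>
  define P :: "'v \<Rightarrow> 'v \<Rightarrow> real" where
    "P w v = of_bool (v = r0 \<or> w = v \<or> v \<notin> C \<and> v = r (\<kappa> v) \<and> w \<notin> C \<and> \<kappa> w = \<kappa> v)" for w v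
  \<comment> \<open>Column v lists the coordinates of L applied to column v of \<open>P\<close>. Let
    c = |C|, and let K be the class of v and m its size. Then L e_v = |V| e_v - 1 for v in C, L 1_K
    = c 1_K - m 1_C, and L e_v = (c + m) e_v - 1_K - 1_C for a non-representative v. If that class
    is k0, then 1_K + 1_C is rewritten as the all-ones vector minus the other indicators.\<close>
  define T :: "'v \<Rightarrow> 'v \<Rightarrow> real" where
    "T w v = (if v = r0 then 0
      else if v \<in> C then real (card V) * of_bool (w = v) - of_bool (w = r0)
      else if v = r (\<kappa> v) then ?c * of_bool (w = v) - ?m (\<kappa> v) * of_bool (w \<in> C)
      else (?c + ?m (\<kappa> v)) * of_bool (w = v) - of_bool (w = r (\<kappa> v))
        - (if \<kappa> v = k0 then - of_bool (w \<in> r ` (I - {k0})) else of_bool (w \<in> C)))" for w v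
  \<comment> \<open>Up to a multiple of itself, each basis vector is sent by L to a combination of
    vectors of lower rank, so \<open>T\<close> is upper triangular. \<open>P\<close> is lower
    triangular in the same order, since an indicator extends beyond its representative only to
    vertices of rank 3.\<close>
  define \<rho> :: "'v \<Rightarrow> nat" where
    "\<rho> v = (if v = r0 then 0 else if v \<in> C then 1 else if v = r (\<kappa> v) then 2 else 3)" for v

  have L: "(\<Sum>w\<in>V. ?L u w * f w) = (if u \<in> C then real (card V) * f u - sum f V
      else (?c + ?m (\<kappa> u)) * f u - sum f C - sum f (K (\<kappa> u)))" if "u \<in> V" for u f
  proof (cases "u \<in> C")
    case True
    then have "{w. w \<in> V \<and> R u w} = V" using that R by auto
    then show ?thesis using True that fin by (simp add: laplacian_kernel_apply sum_subtractf)
  next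
    case False
    then have "{w. w \<in> V \<and> R u w} = C \<union> K (\<kappa> u)" using that R C(1) by (auto simp: K_def)
    moreover have "C \<inter> K (\<kappa> u) = {}" by (auto simp: K_def)
    ultimately have "(\<Sum>w\<in>V. ?L u w * f w) = (\<Sum>w\<in>C. f u - f w) + (\<Sum>w\<in>K (\<kappa> u). f u - f w)"
      using that fin by (simp add: laplacian_kernel_apply sum.union_disjoint)
    then show ?thesis using False by (simp add: sum_subtractf algebra_simps)
  qed

  \<comment> \<open>Each delta in \<open>T\<close> selects one column of \<open>P\<close>, so P T
    becomes a combination of columns that can be compared with L.\<close>
  have PT: "(\<Sum>w\<in>V. P u w * T w v) = (if v = r0 then 0
      else if v \<in> C then real (card V) * P u v - P u r0
      else if v = r (\<kappa> v) then ?c * P u v - ?m (\<kappa> v) * (\<Sum>w\<in>C. P u w)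
      else (?c + ?m (\<kappa> v)) * P u v - P u (r (\<kappa> v))
        - (if \<kappa> v = k0 then - (\<Sum>k\<in>I - {k0}. P u (r k)) else (\<Sum>w\<in>C. P u w)))"
    if "v \<in> V" for u v
  proof -
    have one: "(\<Sum>w\<in>V. P u w * of_bool (w = z)) = P u z" if "z \<in> V" for z
      using that fin(1) by simp
    have C': "(\<Sum>w\<in>V. P u w * of_bool (w \<in> C)) = (\<Sum>w\<in>C. P u w)"
      using C(1) fin by (simp add: Int_absorb1)
    have "V \<inter> {w. w \<in> r ` (I - {k0})} = r ` (I - {k0})" using r(1) by auto
    then have I': "(\<Sum>w\<in>V. P u w * of_bool (w \<in> r ` (I - {k0}))) = (\<Sum>k\<in>I - {k0}. P u (r k))"
      using fin r_inj by (simp add: sum.reindex inj_on_def)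
    have "v \<notin> C \<Longrightarrow> r (\<kappa> v) \<in> V" using r(1) \<kappa>I that by auto
    then show ?thesis
      unfolding T_def
      by (simp add: ring_distribs sum_subtractf sum.distrib sum_negf mult.left_commute[of "P _ _"]
          sum_distrib_left[symmetric] one[OF that] one[OF r0(1)] one C' I' del: sum_mult_of_bool_eq)
  qed

  have P_r0: "P u r0 = 1" for u by (simp add: P_def)
  have P_C: "P u v = of_bool (u = v)" if "v \<in> C" for u v
    using that r0 by (auto simp: P_def)
  \<comment> \<open>For k0 this fails: the column of its representative is the all-ones
    vector.\<close>
  have P_r: "P u (r k) = of_bool (u \<notin> C \<and> \<kappa> u = k)" if "k \<in> I" "k \<noteq> k0" for u k
    using that r r_inj k0 by (auto simp: P_def r0_def)
  have P_other: "P u v = of_bool (u = v)" if "v \<notin> C" "v \<noteq> r0" "v \<noteq> r (\<kappa> v)" for u v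
    using that by (auto simp: P_def)
  have sum_delta: "(\<Sum>w\<in>S. of_bool (w = v)) = (of_bool (v \<in> S) :: real)" if "finite S" for S and v :: 'v
  proof -
    have "S \<inter> {w. w = v} = (if v \<in> S then {v} else {})" by auto
    then show ?thesis using that by simp
  qed
  have sum_C: "(\<Sum>w\<in>C. P u w) = of_bool (u \<in> C)" for u
  proof -
    have "(\<Sum>w\<in>C. P u w) = (\<Sum>w\<in>C. of_bool (w = u))"
      by (intro sum.cong) (auto simp: P_C)
    then show ?thesis using sum_delta[OF fin(2), of u] by simp
  qed
  have sum_r: "(\<Sum>k\<in>I - {k0}. P u (r k)) = of_bool (u \<notin> C \<and> \<kappa> u \<noteq> k0)" if "u \<in> V" for u
  proof -
    have "(\<Sum>k\<in>I - {k0}. P u (r k)) = (\<Sum>k\<in>I - {k0}. of_bool (u \<notin> C \<and> \<kappa> u = k))"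
      by (intro sum.cong) (auto simp: P_r)
    also have "\<dots> = real (card ((I - {k0}) \<inter> {k. u \<notin> C \<and> \<kappa> u = k}))"
      using fin(3) by simp
    also have "(I - {k0}) \<inter> {k. u \<notin> C \<and> \<kappa> u = k} = (if u \<notin> C \<and> \<kappa> u \<noteq> k0 then {\<kappa> u} else {})"
      using \<kappa>I[OF that] by auto
    finally show ?thesis by simp
  qed
  have LP: "(\<Sum>w\<in>V. ?L u w * P w v) = (\<Sum>w\<in>V. P u w * T w v)" if uv: "u \<in> V" "v \<in> V" for u v
  proof -
    note LPT = L[OF uv(1)] PT[OF uv(2)]
    consider "v = r0" | "v \<in> C" "v \<noteq> r0" | "v \<notin> C" "v \<noteq> r0" "v = r (\<kappa> v)"
      | "v \<notin> C" "v \<noteq> r0" "v \<noteq> r (\<kappa> v)" by blast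
    then show ?thesis
    proof cases
      case 1
      then show ?thesis unfolding LPT by (simp add: P_r0)
    next
      case 2
      then have "v \<notin> K k" for k by (simp add: K_def)
      with 2 show ?thesis
        using uv unfolding LPT by (auto simp: P_r0 P_C sum_delta fin simp del: sum_of_bool_eq)
    next
      case 3
      define k where "k = \<kappa> v"
      have k: "k \<in> I" "k \<noteq> k0" "v = r k" using 3 \<kappa>I uv by (auto simp: k_def r0_def)
      have Pv: "P w v = of_bool (w \<notin> C \<and> \<kappa> w = k)" for w
        unfolding k(3) using P_r k by simp
      have "V \<inter> {w. w \<notin> C \<and> \<kappa> w = k} = K k" "C \<inter> {w. w \<notin> C \<and> \<kappa> w = k} = {}"
        "K l \<inter> {w. w \<notin> C \<and> \<kappa> w = k} = (if l = k then K k else {})" for l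
        by (auto simp: K_def)
      then show ?thesis
        unfolding LPT
        by (simp add: 3(1,2) k_def[symmetric] k(3)[symmetric] sum_C Pv fin algebra_simps)
    next
      case 4
      have "v \<in> K l \<longleftrightarrow> \<kappa> v = l" for l using 4 uv by (auto simp: K_def)
      then have sums: "(\<Sum>w\<in>V. P w v) = 1" "(\<Sum>w\<in>C. P w v) = 0"
        "(\<Sum>w\<in>K l. P w v) = of_bool (\<kappa> v = l)" for l
        unfolding P_other[OF 4] using sum_delta[OF fin(1)] sum_delta[OF fin(2)] sum_delta[OF fin(4)] uv 4(1)
        by (simp_all del: sum_of_bool_eq)
      \<comment> \<open>For class k0 this column is all ones, and \<open>sum_r\<close> is what has
        to be subtracted from it to recover 1_K + 1_C.\<close>
      have r: "P u (r (\<kappa> v)) = (if \<kappa> v = k0 then 1 else of_bool (u \<notin> C \<and> \<kappa> u = \<kappa> v))"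
        using P_r[OF \<kappa>I[OF uv(2) 4(1)]] by (simp add: P_r0 r0_def[symmetric])
      show ?thesis
        unfolding LPT sums sum_C sum_r[OF uv(1)] r unfolding P_other[OF 4] using 4
        by (cases "u = v"; cases "u \<in> C"; cases "\<kappa> v = k0"; cases "\<kappa> u = \<kappa> v") simp_all
    qed
  qed
  have "char_poly (kernel_matrix xs xs ?L) = (\<Prod>v\<in>set xs. [:- T v v, 1:])"
  proof (rule char_poly_kernel_matrix_triangularizable[where P = P and T = T and \<rho> = \<rho>])
    fix u v assume uv: "u \<in> set xs" "v \<in> set xs"
    then have uv': "u \<in> V" "v \<in> V" by (simp_all add: xs(2))
    show "(\<Sum>w\<in>set xs. ?L u w * P w v) = (\<Sum>w\<in>set xs. P u w * T w v)"
      using LP uv by (simp add: xs(2))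
    have \<rho>_r: "\<rho> (r k) \<le> 2" if "k \<in> I" for k
      using r(2)[OF that] by (simp add: \<rho>_def)
    have \<rho>_C: "\<rho> w \<le> 2" if "w \<in> C" for w
      using that by (simp add: \<rho>_def)
    \<comment> \<open>Class k0 has no vertex of rank 2: its representative already has rank
      0.\<close>
    have "w = r0" if "w = r (\<kappa> w)" "\<kappa> w = k0" for w
      using that by (simp add: r0_def)
    then show "\<rho> v < \<rho> u" if "u \<noteq> v" "P u v \<noteq> 0"
      using that r0 by (auto simp: P_def \<rho>_def split: if_splits)
    show "\<rho> u < \<rho> v" if "u \<noteq> v" "T u v \<noteq> 0"
    proof (cases "v = r0 \<or> v \<in> C \<or> v = r (\<kappa> v)")
      case True
      then show ?thesis using that r0 by (auto simp: T_def \<rho>_def split: if_splits)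
    next
      case False
      \<comment> \<open>Off the diagonal, a column of the last kind is supported on C and the
        representatives, all of rank at most 2.\<close>
      have "u \<in> r ` I \<or> u \<in> C"
      proof (rule ccontr)
        assume "\<not> (u \<in> r ` I \<or> u \<in> C)"
        then have "u \<noteq> r (\<kappa> v)" "u \<notin> r ` (I - {k0})" "u \<notin> C"
          using False \<kappa>I uv' by auto
        then have "T u v = 0" using False that(1) by (simp add: T_def)
        then show False using that(2) by simp
      qed
      then have "\<rho> u \<le> 2" using \<rho>_r \<rho>_C by blast
      then show ?thesis using False by (simp add: \<rho>_def)
    qed
  qed (simp_all add: xs P_def)
  \<comment> \<open>The diagonal of \<open>T\<close> is |V| on C, |C| + |K| at a non-representative
    of K, and |C| at a representative, except for 0 at r0. Hence the exponents
    \<open>card (K k) - 1\<close> and \<open>card I - 1\<close>.\<close>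
  also have "(\<Prod>v\<in>set xs. [:- T v v, 1:]) = [:0, 1:] * [:- real (card V), 1:] ^ card C * [:- ?c, 1:] ^ (card I - 1)
      * (\<Prod>k\<in>I. [:- real (card C + card (K k)), 1:] ^ (card (K k) - 1))"
  proof -
    let ?d = "\<lambda>v. [:- T v v, 1:]"
    have "(\<Prod>v\<in>set xs. ?d v) = (\<Prod>v\<in>V. ?d v)" by (simp add: xs(2))
    also have "(\<Prod>v\<in>V. ?d v) = (\<Prod>v\<in>C. ?d v) * (\<Prod>v\<in>V - C. ?d v)"
      using prod.subset_diff[OF C(1) fin(1), of ?d] by (simp add: mult.commute)
    also have "(\<Prod>v\<in>C. ?d v) = (\<Prod>v\<in>C. [:- real (card V), 1:])"
      using r0 by (intro prod.cong) (auto simp: T_def)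
    also have "(\<Prod>v\<in>V - C. ?d v) = (\<Prod>k\<in>I. \<Prod>v\<in>K k. ?d v)"
      unfolding K_def I_def using fin(1) by (intro prod.group[symmetric]) auto
    also have "\<dots> = (\<Prod>k\<in>I. ?d (r k) * [:- real (card C + card (K k)), 1:] ^ (card (K k) - 1))"
    proof (intro prod.cong HOL.refl)
      fix k assume k: "k \<in> I"
      then have rK: "r k \<in> K k" using r by (auto simp: K_def)
      have "?d v = [:- real (card C + card (K k)), 1:]" if "v \<in> K k - {r k}" for v
      proof -
        have "v \<notin> C" "\<kappa> v = k" "v \<noteq> r k" "v \<noteq> r0" "v \<notin> r ` (I - {k0})"
          using that r r0 r0_def by (auto simp: K_def)
        then show ?thesis by (simp add: T_def)
      qed
      then have "(\<Prod>v\<in>K k - {r k}. ?d v) = [:- real (card C + card (K k)), 1:] ^ (card (K k) - 1)"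
        using rK by simp
      then show "(\<Prod>v\<in>K k. ?d v) = ?d (r k) * [:- real (card C + card (K k)), 1:] ^ (card (K k) - 1)"
        using prod.remove[OF fin(4) rK, of ?d] by simp
    qed
    also have "\<dots> = (\<Prod>k\<in>I. ?d (r k)) * (\<Prod>k\<in>I. [:- real (card C + card (K k)), 1:] ^ (card (K k) - 1))"
      by (rule prod.distrib)
    also have "(\<Prod>k\<in>I. ?d (r k)) = [:0, 1:] * (\<Prod>k\<in>I - {k0}. ?d (r k))"
      using prod.remove[OF fin(3) k0, of "\<lambda>k. ?d (r k)"] by (simp add: T_def r0_def)
    also have "(\<Prod>k\<in>I - {k0}. ?d (r k)) = (\<Prod>k\<in>I - {k0}. [:- ?c, 1:])"
    proof (intro prod.cong HOL.refl)
      fix k assume "k \<in> I - {k0}"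
      then have "r k \<noteq> r0" "r k \<notin> C" "\<kappa> (r k) = k" using r r_inj k0 by (auto simp: r0_def)
      then show "?d (r k) = [:- ?c, 1:]" by (simp add: T_def)
    qed
    finally show ?thesis using fin k0 by (simp add: mult_ac)
  qed
  finally show ?thesis by (simp add: I_def)
qed

section \<open>Transport to the commuting graph of a group\<close>

text \<open>This lets the computation run on exponent pairs instead of classes of words.\<close>

lemma laplacian_kernel_image:
  assumes "inj_on f X" and "u \<in> X" and "v \<in> X"
  shows "laplacian_kernel (f ` X) R (f u) (f v) = laplacian_kernel X (\<lambda>x y. R (f x) (f y)) u v"
proof -
  have "{w \<in> f ` X. w \<noteq> f u \<and> R (f u) w} = f ` {w \<in> X. w \<noteq> u \<and> R (f u) (f w)}"
    using assms by (auto simp: inj_on_eq_iff)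
  moreover have "inj_on f {w \<in> X. w \<noteq> u \<and> R (f u) (f w)}"
    using assms(1) by (rule inj_on_subset) auto
  ultimately have "card {w \<in> f ` X. w \<noteq> f u \<and> R (f u) w} = card {w \<in> X. w \<noteq> u \<and> R (f u) (f w)}"
    by (simp only: card_image)
  then show ?thesis
    using inj_on_eq_iff[OF assms] by (simp only: laplacian_kernel_def)
qed

lemma laplacian_matrix_commuting_graph:
  assumes "distinct vs" and "set vs = carrier G"
  shows "laplacian_matrix (commuting_graph G) vs
    = kernel_matrix vs vs (laplacian_kernel (carrier G) (\<lambda>x y. x \<otimes>\<^bsub>G\<^esub> y = y \<otimes>\<^bsub>G\<^esub> x))"
proof -
  have mem: "vs ! i \<in> carrier G" if "i < length vs" for i
    using that assms(2) nth_mem by blast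
  have "out_degree (with_proj (commuting_graph G)) v
      = card {w \<in> carrier G. w \<noteq> v \<and> v \<otimes>\<^bsub>G\<^esub> w = w \<otimes>\<^bsub>G\<^esub> v}" if "v \<in> carrier G" for v
  proof -
    have "out_arcs (with_proj (commuting_graph G)) v
        = Pair v ` {w \<in> carrier G. w \<noteq> v \<and> v \<otimes>\<^bsub>G\<^esub> w = w \<otimes>\<^bsub>G\<^esub> v}"
      using that by (auto simp: out_arcs_def commuting_graph_def)
    then show ?thesis by (simp add: out_degree_def card_image inj_on_def)
  qed
  then show ?thesis
    using assms(1) mem
    by (intro eq_matI) (auto simp: laplacian_matrix_def degree_matrix_def adjacency_matrix_def
        kernel_matrix_def laplacian_kernel_def nth_eq_iff_index_eq commuting_graph_def)
qed

section \<open>Normal forms in the semidihedral group\<close>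

lemma word_class_word_power:
  "word_class R (word_power w k) = word_class R w [^]\<^bsub>presented_group R\<^esub> k"
proof (induction k)
  case 0
  show ?case by (simp add: word_power_def presented_group_def nat_pow_def)
next
  case (Suc k)
  have "word_power w (Suc k) = word_power w k @ w"
    by (simp add: word_power_def flip: replicate_append_same)
  then show ?case
    by (simp add: Suc flip: presented_group_mult)
qed

abbreviation SD_class :: "nat \<Rightarrow> sd_generator word \<Rightarrow> sd_generator word set" where
  "SD_class n \<equiv> word_class (SD_relations n)"

text \<open>The normal form a^i b^j, with unreduced exponent so that products need no remainder;
  \<open>sd_elem_mod\<close> and \<open>sd_elem_eq_iff\<close> account for the periodicity.\<close>

definition sd_elem :: "nat \<Rightarrow> nat \<times> bool \<Rightarrow> sd_generator word set" where
  "sd_elem n = (\<lambda>(i, j). SD_class n word_a [^]\<^bsub>SD n\<^esub> i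
    \<otimes>\<^bsub>SD n\<^esub> (if j then SD_class n word_b else \<one>\<^bsub>SD n\<^esub>))"

lemma SD_class_carrier [simp]: "SD_class n w \<in> carrier (SD n)"
  by (simp add: SD_def presented_group_def)

lemma SD_class_append: "SD_class n (u @ v) = SD_class n u \<otimes>\<^bsub>SD n\<^esub> SD_class n v"
  by (simp add: SD_def presented_group_mult)

lemma SD_class_Nil: "SD_class n [] = \<one>\<^bsub>SD n\<^esub>"
  by (simp add: SD_def presented_group_def)

lemma
  shows SD_a_pow: "SD_class n word_a [^]\<^bsub>SD n\<^esub> (4 * n) = \<one>\<^bsub>SD n\<^esub>"
    and SD_b_square: "SD_class n word_b \<otimes>\<^bsub>SD n\<^esub> SD_class n word_b = \<one>\<^bsub>SD n\<^esub>"
    and SD_b_a: "SD_class n word_b \<otimes>\<^bsub>SD n\<^esub> SD_class n word_a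
      = SD_class n word_a [^]\<^bsub>SD n\<^esub> (2 * n - 1) \<otimes>\<^bsub>SD n\<^esub> SD_class n word_b"
proof -
  have rel: "SD_class n u = SD_class n v" if "(u, v) \<in> SD_relations n" for u v
    unfolding word_class_eq_iff using that by (rule word_eq.relation)
  have pow: "SD_class n (word_power w k) = SD_class n w [^]\<^bsub>SD n\<^esub> k" for w k
    by (simp add: SD_def word_class_word_power)
  show "SD_class n word_a [^]\<^bsub>SD n\<^esub> (4 * n) = \<one>\<^bsub>SD n\<^esub>"
    unfolding pow[symmetric] SD_class_Nil[symmetric] by (rule rel) (simp add: SD_relations_def)
  show "SD_class n word_b \<otimes>\<^bsub>SD n\<^esub> SD_class n word_b = \<one>\<^bsub>SD n\<^esub>"
    unfolding SD_class_append[symmetric] SD_class_Nil[symmetric]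
    by (rule rel) (simp add: SD_relations_def word_power_def numeral_2_eq_2)
  show "SD_class n word_b \<otimes>\<^bsub>SD n\<^esub> SD_class n word_a
      = SD_class n word_a [^]\<^bsub>SD n\<^esub> (2 * n - 1) \<otimes>\<^bsub>SD n\<^esub> SD_class n word_b"
    unfolding pow[symmetric] SD_class_append[symmetric]
    by (rule rel) (simp add: SD_relations_def)
qed

lemma sd_elem_carrier [simp]: "sd_elem n p \<in> carrier (SD n)"
proof -
  interpret group "SD n" by (rule group_SD)
  show ?thesis by (simp add: sd_elem_def split: prod.split)
qed

lemma sd_elem_mult:
  "sd_elem n (i, j) \<otimes>\<^bsub>SD n\<^esub> sd_elem n (k, l)
    = sd_elem n (i + (if j then (2 * n - 1) * k else k), j \<noteq> l)"
proof -
  interpret group "SD n" by (rule group_SD)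
  let ?a = "SD_class n word_a" and ?b = "SD_class n word_b"
  have ba: "?b \<otimes>\<^bsub>SD n\<^esub> ?a [^]\<^bsub>SD n\<^esub> k = ?a [^]\<^bsub>SD n\<^esub> ((2 * n - 1) * k) \<otimes>\<^bsub>SD n\<^esub> ?b" for k
  proof (induction k)
    case (Suc k)
    have "?b \<otimes>\<^bsub>SD n\<^esub> ?a [^]\<^bsub>SD n\<^esub> Suc k = (?b \<otimes>\<^bsub>SD n\<^esub> ?a [^]\<^bsub>SD n\<^esub> k) \<otimes>\<^bsub>SD n\<^esub> ?a"
      by (simp add: m_assoc)
    also have "\<dots> = ?a [^]\<^bsub>SD n\<^esub> ((2 * n - 1) * k) \<otimes>\<^bsub>SD n\<^esub> (?b \<otimes>\<^bsub>SD n\<^esub> ?a)"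
      by (simp add: Suc m_assoc)
    also have "\<dots> = ?a [^]\<^bsub>SD n\<^esub> ((2 * n - 1) * k + (2 * n - 1)) \<otimes>\<^bsub>SD n\<^esub> ?b"
      unfolding SD_b_a by (simp add: m_assoc[symmetric] nat_pow_mult)
    finally show ?case by (simp add: add.commute)
  qed simp
  show ?thesis
  proof (cases j)
    case True
    have "sd_elem n (i, True) \<otimes>\<^bsub>SD n\<^esub> sd_elem n (k, l)
        = ?a [^]\<^bsub>SD n\<^esub> i \<otimes>\<^bsub>SD n\<^esub> (?b \<otimes>\<^bsub>SD n\<^esub> ?a [^]\<^bsub>SD n\<^esub> k)
          \<otimes>\<^bsub>SD n\<^esub> (if l then ?b else \<one>\<^bsub>SD n\<^esub>)"
      by (simp add: sd_elem_def m_assoc)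
    also have "\<dots> = ?a [^]\<^bsub>SD n\<^esub> (i + (2 * n - 1) * k)
          \<otimes>\<^bsub>SD n\<^esub> (?b \<otimes>\<^bsub>SD n\<^esub> (if l then ?b else \<one>\<^bsub>SD n\<^esub>))"
      unfolding ba by (simp add: m_assoc nat_pow_mult[symmetric])
    also have "\<dots> = sd_elem n (i + (2 * n - 1) * k, \<not> l)"
      by (simp add: sd_elem_def SD_b_square)
    finally show ?thesis using True by simp
  next
    case False
    then show ?thesis
      by (simp add: sd_elem_def m_assoc[symmetric] nat_pow_mult)
  qed
qed

lemma sd_elem_mod: "sd_elem n (i mod (4 * n), j) = sd_elem n (i, j)"
proof -
  interpret group "SD n" by (rule group_SD)
  let ?a = "SD_class n word_a"
  have "?a [^]\<^bsub>SD n\<^esub> i = ?a [^]\<^bsub>SD n\<^esub> (4 * n * (i div (4 * n)) + i mod (4 * n))"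
    by simp
  also have "\<dots> = (?a [^]\<^bsub>SD n\<^esub> (4 * n)) [^]\<^bsub>SD n\<^esub> (i div (4 * n)) \<otimes>\<^bsub>SD n\<^esub> ?a [^]\<^bsub>SD n\<^esub> (i mod (4 * n))"
    by (simp only: nat_pow_mult nat_pow_pow SD_class_carrier)
  also have "\<dots> = ?a [^]\<^bsub>SD n\<^esub> (i mod (4 * n))"
    by (simp add: SD_a_pow)
  finally show ?thesis by (simp add: sd_elem_def)
qed

text \<open>Normal forms are closed under products by \<open>sd_elem_mult\<close>, so only the four
  letters need one; the inverse letters become a^(4n - 1) and b.\<close>

lemma SD_class_range_sd_elem:
  assumes "n \<ge> 1"
  shows "SD_class n w \<in> range (sd_elem n)"
proof (induction w)
  case Nil
  interpret group "SD n" by (rule group_SD)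
  have "SD_class n [] = sd_elem n (0, False)" by (simp add: sd_elem_def SD_class_Nil)
  then show ?case by blast
next
  case (Cons x w)
  interpret group "SD n" by (rule group_SD)
  let ?a = "SD_class n word_a" and ?b = "SD_class n word_b"
  have inverse: "SD_class n [(g, True)] \<otimes>\<^bsub>SD n\<^esub> SD_class n [(g, False)] = \<one>\<^bsub>SD n\<^esub>" for g
    unfolding SD_class_append[symmetric] SD_class_Nil[symmetric] word_class_eq_iff
    using word_eq.cancel[of "SD_relations n" g True] by simp
  have "?a [^]\<^bsub>SD n\<^esub> (4 * n - 1) \<otimes>\<^bsub>SD n\<^esub> ?a = \<one>\<^bsub>SD n\<^esub>"
    using SD_a_pow[of n] nat_pow_Suc[of ?a "4 * n - 1"] assms by simp
  then have a': "SD_class n [(gen_a, True)] = sd_elem n (4 * n - 1, False)"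
    using right_cancel[of ?a "SD_class n [(gen_a, True)]" "?a [^]\<^bsub>SD n\<^esub> (4 * n - 1)"] inverse[of gen_a]
    by (simp add: sd_elem_def)
  have b': "SD_class n [(gen_b, True)] = sd_elem n (0, True)"
    using right_cancel[of ?b "SD_class n [(gen_b, True)]" ?b] inverse[of gen_b] SD_b_square[of n]
    by (simp add: sd_elem_def)
  have a: "SD_class n word_a = sd_elem n (1, False)" and b: "SD_class n word_b = sd_elem n (0, True)"
    by (simp_all add: sd_elem_def)
  obtain g s where "x = (g, s)" by (cases x)
  then have "SD_class n [x] \<in> range (sd_elem n)"
    using a b a' b' by (cases g; cases s) simp_all
  then show ?case
    using Cons SD_class_append[of n "[x]" w] by (auto simp: sd_elem_mult)
qed

lemma bij_betw_sd_elem: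
  assumes "n \<ge> 1"
  shows "bij_betw (sd_elem n) ({..<4 * n} \<times> UNIV) (carrier (SD n))"
proof -
  let ?X = "{..<4 * n} \<times> (UNIV :: bool set)"
  have mem: "sd_elem n p \<in> sd_elem n ` ?X" for p
  proof (cases p)
    case (Pair i j)
    have "(i mod (4 * n), j) \<in> ?X" using assms by simp
    then show ?thesis unfolding Pair sd_elem_mod[of n i j, symmetric] by (rule imageI)
  qed
  have "SD_class n w \<in> sd_elem n ` ?X" for w
  proof -
    obtain p where "SD_class n w = sd_elem n p"
      using SD_class_range_sd_elem[OF assms, of w] by (rule rangeE)
    then show ?thesis using mem[of p] by simp
  qed
  moreover have "carrier (SD n) = range (SD_class n)"
    by (simp add: SD_def presented_group_def)
  ultimately have "carrier (SD n) \<subseteq> sd_elem n ` ?X"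
    by (simp only: image_subset_iff ball_simps) simp
  then have image: "sd_elem n ` ?X = carrier (SD n)"
    by (intro equalityI image_subsetI sd_elem_carrier)
  \<comment> \<open>Injectivity comes from counting: 8n pairs map onto a group of order 8n.\<close>
  have "inj_on (sd_elem n) ?X"
    using SD_order[OF assms] image
    by (intro eq_card_imp_inj_on) (simp_all add: Coset.order_def card_cartesian_product)
  with image show ?thesis by (simp add: bij_betw_def)
qed

lemma sd_elem_eq_iff:
  assumes "n \<ge> 1"
  shows "sd_elem n (i, j) = sd_elem n (k, l) \<longleftrightarrow> i mod (4 * n) = k mod (4 * n) \<and> j = l"
proof -
  have "sd_elem n (i mod (4 * n), j) = sd_elem n (k mod (4 * n), l)
      \<longleftrightarrow> (i mod (4 * n), j) = (k mod (4 * n), l)"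
    using bij_betw_sd_elem[OF assms] assms
    by (intro inj_on_eq_iff[of _ "{..<4 * n} \<times> UNIV"]) (simp_all add: bij_betw_def)
  then show ?thesis by (simp add: sd_elem_mod)
qed

section \<open>Commutation for odd n\<close>

lemma dvd_twice_pred_mult_iff:
  fixes n x :: int
  assumes "odd n"
  shows "4 * n dvd (2 * n - 2) * x \<longleftrightarrow> n dvd x"
proof -
  obtain m where m: "n = 2 * m + 1" using assms by (rule oddE)
  have "4 * n dvd (2 * n - 2) * x \<longleftrightarrow> 4 * n dvd 4 * (m * x)"
    by (simp add: m algebra_simps)
  also have "\<dots> \<longleftrightarrow> n dvd m * x" by simp
  also have "\<dots> \<longleftrightarrow> n dvd x"
  proof -
    have "coprime n m"
    proof (rule coprimeI)
      fix c assume c: "c dvd n" "c dvd m"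
      then have "c dvd n - 2 * m" by simp
      then show "is_unit c" by (simp add: m)
    qed
    then show ?thesis by (rule coprime_dvd_mult_right_iff)
  qed
  finally show ?thesis .
qed

lemma sd_elem_commute_iff:
  assumes "odd n"
  shows "sd_elem n (i, j) \<otimes>\<^bsub>SD n\<^esub> sd_elem n (k, l) = sd_elem n (k, l) \<otimes>\<^bsub>SD n\<^esub> sd_elem n (i, j)
    \<longleftrightarrow> (if j then if l then i mod n = k mod n else n dvd k else l \<longrightarrow> n dvd i)"
proof -
  have n: "n \<ge> 1" using assms by (cases n) auto
  then have c: "int (2 * n - 1) = 2 * int n - 1" by simp
  have mod_iff: "x mod (4 * n) = y mod (4 * n) \<longleftrightarrow> 4 * int n dvd int y - int x" for x y
  proof -
    have "x mod (4 * n) = y mod (4 * n) \<longleftrightarrow> int y mod int (4 * n) = int x mod int (4 * n)"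
      by (simp only: of_nat_mod[symmetric] of_nat_eq_iff eq_commute)
    then show ?thesis by (simp add: mod_eq_dvd_iff)
  qed
  have odd: "odd (int n)" using assms by simp
  \<comment> \<open>Both products carry the same flag \<open>j \<noteq> l\<close>, so only the
    exponents of a are compared.\<close>
  have comm: "sd_elem n (i, j) \<otimes>\<^bsub>SD n\<^esub> sd_elem n (k, l) = sd_elem n (k, l) \<otimes>\<^bsub>SD n\<^esub> sd_elem n (i, j)
      \<longleftrightarrow> 4 * int n dvd int (k + (if l then (2 * n - 1) * i else i)) - int (i + (if j then (2 * n - 1) * k else k))"
    unfolding sd_elem_mult sd_elem_eq_iff[OF n] mod_iff by auto
  consider "\<not> j" "\<not> l" | "\<not> j" l | j "\<not> l" | j l by blast
  then show ?thesis
  proof cases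
    case 1
    then show ?thesis unfolding comm by simp
  next
    case 2
    have "int (k + (2 * n - 1) * i) - int (i + k) = (2 * int n - 2) * int i"
      unfolding of_nat_add of_nat_mult c by (simp add: algebra_simps)
    with 2 show ?thesis unfolding comm by (simp only: if_True if_False) (simp add: dvd_twice_pred_mult_iff[OF odd])
  next
    case 3
    have "int (k + i) - int (i + (2 * n - 1) * k) = (2 * int n - 2) * (- int k)"
      unfolding of_nat_add of_nat_mult c by (simp add: algebra_simps)
    with 3 show ?thesis unfolding comm by (simp only: if_True if_False) (simp add: dvd_twice_pred_mult_iff[OF odd])
  next
    case 4
    have "int (k + (2 * n - 1) * i) - int (i + (2 * n - 1) * k) = (2 * int n - 2) * (int i - int k)"
      unfolding of_nat_add of_nat_mult c by (simp add: algebra_simps)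
    then have "?thesis \<longleftrightarrow> (int n dvd int i - int k \<longleftrightarrow> i mod n = k mod n)"
      unfolding comm using 4 by (simp only: if_True if_False dvd_twice_pred_mult_iff[OF odd])
    then show ?thesis
      by (simp add: mod_eq_dvd_iff[symmetric] flip: of_nat_mod)
  qed
qed

section \<open>Class sizes and the resulting spectrum\<close>

text \<open>Applied with m = 4, it gives the size of the centre (r = 0) and of each class of
  elements a^i b.\<close>

lemma card_residue_class:
  fixes n r m :: nat
  assumes "r < n"
  shows "card {i. i < m * n \<and> i mod n = r} = m"
proof -
  have "{i. i < m * n \<and> i mod n = r} = (\<lambda>q. q * n + r) ` {..<m}" (is "?A = ?B")
  proof
    show "?A \<subseteq> ?B"
    proof
      fix i assume "i \<in> ?A"
      then have "i = i div n * n + r" "i div n < m" by (auto simp: less_mult_imp_div_less)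
      then show "i \<in> ?B" by blast
    qed
    show "?B \<subseteq> ?A"
    proof
      fix i assume "i \<in> ?B"
      then obtain q where q: "q < m" "i = q * n + r" by auto
      have "q * n + r < Suc q * n" using assms by simp
      also have "\<dots> \<le> m * n" using q(1) by (intro mult_right_mono) auto
      finally show "i \<in> ?A" using q assms by simp
    qed
  qed
  then show ?thesis using assms by (simp add: card_image inj_on_def)
qed

theorem theorem4p21:
  fixes n :: nat and vs :: "sd_generator word set list"
  assumes "n \<ge> 3" and "odd n"
    and "distinct vs" and "set vs = pverts (commuting_graph (SD n))"
  shows "char_poly (laplacian_matrix (commuting_graph (SD n)) vs) =
    [:0, 1:] * [:- real (8 * n), 1:] ^ 4 * [:- 4, 1:] ^ n * [:- 8, 1:] ^ (3 * n)
      * [:- real (4 * n), 1:] ^ (4 * n - 5)"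
proof -
  define X where "X = {..<4 * n} \<times> (UNIV :: bool set)"
  define C where "C = {i. i < 4 * n \<and> i mod n = 0} \<times> {False}"
  \<comment> \<open>\<open>None\<close> labels the powers of a, and \<open>Some r\<close> the
    elements a^i b with i = r modulo n. The central elements also get \<open>None\<close>;
    subtracting \<open>C\<close> in \<open>K\<close> removes them.\<close>
  define \<kappa> :: "nat \<times> bool \<Rightarrow> nat option" where "\<kappa> = (\<lambda>(i, j). if j then Some (i mod n) else None)"
  define K where "K k = {p \<in> X - C. \<kappa> p = k}" for k
  define R where "R x y \<longleftrightarrow> x \<otimes>\<^bsub>SD n\<^esub> y = y \<otimes>\<^bsub>SD n\<^esub> x" for x y
  \<comment> \<open>The given enumeration is pulled back to exponent pairs, so the result holds for
    every ordering \<open>vs\<close>.\<close>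
  define xs where "xs = map (inv_into X (sd_elem n)) vs"
  have n: "n \<ge> 1" "0 < n" using assms(1) by simp_all
  have bij: "bij_betw (sd_elem n) X (carrier (SD n))"
    unfolding X_def by (rule bij_betw_sd_elem[OF n(1)])
  have vs: "set vs = carrier (SD n)" using assms(4) by (simp add: commuting_graph_def)
  have xs: "distinct xs" "set xs = X" "vs = map (sd_elem n) xs"
    using bij_betw_inv_into[OF bij] vs assms(3)
    by (auto simp: xs_def distinct_map bij_betw_def comp_def bij_betw_inv_into_right[OF bij]
        intro!: map_idI[symmetric])

  have "laplacian_matrix (commuting_graph (SD n)) vs = kernel_matrix vs vs (laplacian_kernel (carrier (SD n)) R)"
    unfolding R_def by (rule laplacian_matrix_commuting_graph[OF assms(3) vs])
  also have "\<dots> = kernel_matrix xs xs (\<lambda>u v. laplacian_kernel (carrier (SD n)) R (sd_elem n u) (sd_elem n v))"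
    unfolding xs(3) by (intro eq_matI) (simp_all add: kernel_matrix_def)
  also have "\<dots> = kernel_matrix xs xs (laplacian_kernel X (\<lambda>p q. R (sd_elem n p) (sd_elem n q)))"
    using bij laplacian_kernel_image[of "sd_elem n" X]
    by (intro kernel_matrix_cong) (simp add: bij_betw_def xs(2))
  finally have "char_poly (laplacian_matrix (commuting_graph (SD n)) vs)
      = char_poly (kernel_matrix xs xs (laplacian_kernel X (\<lambda>p q. R (sd_elem n p) (sd_elem n q))))"
    by simp
  also have "\<dots> = [:0, 1:] * [:- real (card X), 1:] ^ card C * [:- real (card C), 1:] ^ (card (\<kappa> ` (X - C)) - 1)
      * (\<Prod>k\<in>\<kappa> ` (X - C). [:- real (card C + card (K k)), 1:] ^ (card (K k) - 1))"
    unfolding K_def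
  proof (rule char_poly_laplacian_join_cliques[OF xs(1,2)])
    show "C \<subseteq> X" by (auto simp: C_def X_def)
    have "(0, True) \<in> X - C" using n by (simp add: C_def X_def)
    then show "C \<noteq> X" by blast
    show "R (sd_elem n p) (sd_elem n q) \<longleftrightarrow> p \<in> C \<or> q \<in> C \<or> \<kappa> p = \<kappa> q"
      if "p \<in> X" "q \<in> X" for p q
      using that
      by (cases p; cases q) (auto simp: R_def sd_elem_commute_iff[OF assms(2)] C_def X_def \<kappa>_def)
  qed
  also have "card X = 8 * n"
    by (simp add: X_def card_cartesian_product)
  also have C: "card C = 4"
    using card_residue_class[of 0 n 4] n by (simp add: C_def card_cartesian_product)
  also have I: "\<kappa> ` (X - C) = insert None (Some ` {..<n})"
  proof
    show "\<kappa> ` (X - C) \<subseteq> insert None (Some ` {..<n})" using n by (auto simp: \<kappa>_def)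
    \<comment> \<open>Here n > 1 enters: a is not central, so the class \<open>None\<close> is
      nonempty.\<close>
    have "(1, False) \<in> X - C" using assms(1) by (simp add: X_def C_def)
    moreover have "(r, True) \<in> X - C" if "r < n" for r using that by (simp add: X_def C_def)
    ultimately show "insert None (Some ` {..<n}) \<subseteq> \<kappa> ` (X - C)"
      by (force simp: \<kappa>_def image_iff)
  qed
  also have "card (insert None (Some ` {..<n})) - 1 = n"
    by (simp add: card_image)
  \<comment> \<open>The class \<open>None\<close> has 4n - 4 elements and gives the eigenvalue 4 +
    (4n - 4) = 4n with multiplicity 4n - 5; each of the n others has 4 elements and gives 4 + 4 = 8
    with multiplicity 3.\<close>
  also have "(\<Prod>k\<in>insert None (Some ` {..<n}). [:- real (4 + card (K k)), 1:] ^ (card (K k) - 1))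
      = [:- real (4 * n), 1:] ^ (4 * n - 5) * [:- 8, 1:] ^ (3 * n)"
  proof -
    have "K None = {..<4 * n} \<times> {False} - C" by (auto simp: K_def X_def \<kappa>_def)
    moreover have "C \<subseteq> {..<4 * n} \<times> {False}" by (auto simp: C_def)
    ultimately have None: "card (K None) = 4 * n - 4"
      using C by (simp add: card_Diff_subset finite_subset card_cartesian_product)
    have "K (Some r) = {i. i < 4 * n \<and> i mod n = r} \<times> {True}" for r
      by (auto simp: K_def X_def C_def \<kappa>_def split: if_splits)
    then have Some: "card (K (Some r)) = 4" if "r < n" for r
      using card_residue_class[OF that, of 4] by (simp add: card_cartesian_product)
    have "(\<Prod>k\<in>Some ` {..<n}. [:- real (4 + card (K k)), 1:] ^ (card (K k) - 1)) = (\<Prod>r<n. [:- 8, 1:] ^ 3)"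
      by (simp add: prod.reindex Some)
    also have "\<dots> = [:- 8, 1:] ^ (3 * n)" by (simp add: power_mult)
    finally show ?thesis
      using None assms(1) by (subst prod.insert) (auto simp: of_nat_diff)
  qed
  finally show ?thesis by (simp add: mult_ac)
qed

end
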